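(* Let $\Gamma=(G,v_0,\mathcal{L})$ be a terminal game that satisfies condition (CIW): infinite plays are worse than any terminal play for all players, i.e. $\mathcal{L}^i(w)<0$ for all $i\in I$ and $w\in V_T$. Then there exist positive local cost functions $\ell^i:E\to\mathbb{R}$, $i\in I$ (i.e. $\ell^i(e)>0$ for all $e\in E$), such that for the positive shortest path game $\Gamma'=(G,v_0,\ell)$, every situation $\sigma$ that is a terminal Nash equilibrium of $\Gamma'$ is also a Nash equilibrium of $\Gamma$.
   Context: **Common setting.** $G=(V,E)$ is a finite directed graph; vertices are positions, directed edges are moves. $I=\{1,\dots,n\}$ is the set of players. $V=V_1\cup\dots\cup V_n\cup V_T$ is a given partition of $V$, where $V_i$ is the set of positions controlled by player $i$ and $V_T\ne\emptyset$ is the set of terminal positions; terminals are exactly the positions with no outgoing edge. $v_0\in V\setminus V_T$ is the initial position. A (pure stationary) strategy of player $i$ is a map $\sigma_i:V_i\to V$ with $(v,\sigma_i(v))\in E$ for all $v\in V_i$. A situation is a tuple $\sigma=(\sigma_i\mid i\in I)$ of strategies. The play $P(\sigma)$ is the directed walk starting at $v_0$ that from each position $v\in V_i$ moves to $\sigma_i(v)$; it either reaches a terminal and stops (terminal play), or is infinite. All players minimize their effective cost. A situation $\sigma$ is a Nash equilibrium (NE) if no player $i$ can strictly decrease his effective cost by changing only his own strategy $\sigma_i$; it is a terminal NE if moreover $P(\sigma)$ is a terminal play. **Terminal game** $(G,v_0,\mathcal{L})$: $\mathcal{L}=(\mathcal{L}^i\mid i\in I)$ with $\mathcal{L}^i:V_T\to\mathbb{R}$.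 The effective cost $\mathcal{L}^i(\sigma)$ is $\mathcal{L}^i(w)$ if $P(\sigma)$ terminates at $w\in V_T$, and $0$ if $P(\sigma)$ is infinite. **Positive shortest path game** $(G,v_0,\ell)$: $\ell=(\ell^i\mid i\in I)$ with $\ell^i:E\to\mathbb{R}$ positive. The effective cost is $\ell^i(\sigma)=\sum_{(u,v)\in P(\sigma)}\ell^i(u,v)$ for a terminal play, and $+\infty$ for an infinite play. Both games use the same $G$, the same partition of $V$, and hence the same situations. *)

theory Defs
  imports "HOL-Library.FuncSet" "HOL-Library.Disjoint_Sets" "HOL-Library.Extended_Real"
    "Graph_Theory.Pair_Digraph"
begin

record 'v arena =
  board :: "'v pair_pre_digraph"
  num_players :: nat
  controlled :: "nat \<Rightarrow> 'v set"
  terminals :: "'v set"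
  start :: 'v

abbreviation players :: "'v arena \<Rightarrow> nat set" where
  "players A \<equiv> {1..num_players A}"

abbreviation positions :: "'v arena \<Rightarrow> 'v set" where
  "positions A \<equiv> pverts (board A)"

abbreviation moves :: "'v arena \<Rightarrow> ('v \<times> 'v) set" where
  "moves A \<equiv> parcs (board A)"

text \<open>
  Loops are allowed, parallel edges are not. The set controlled by a player may be empty.
\<close>
locale game_arena =
  fixes A :: "'v arena"
  assumes finite_digraph: "pair_fin_digraph (board A)"
    and positions_cover: "positions A = (\<Union>i\<in>players A. controlled A i) \<union> terminals A"
    and controlled_disjoint: "disjoint_family_on (controlled A) (players A)"
    and terminals_disjoint: "\<And>i. i \<in> players A \<Longrightarrow> controlled A i \<inter> terminals A = {}"
    and terminals_nonempty: "terminals A \<noteq> {}"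
    and terminals_iff: "\<And>v. v \<in> positions A \<Longrightarrow> v \<in> terminals A \<longleftrightarrow> \<not> (\<exists>u. (v, u) \<in> moves A)"
    and start_position: "start A \<in> positions A - terminals A"

definition strategies :: "'v arena \<Rightarrow> nat \<Rightarrow> ('v \<Rightarrow> 'v) set" where
  "strategies A i = (\<Pi>\<^sub>E v\<in>controlled A i. {u. (v, u) \<in> moves A})"

definition situations :: "'v arena \<Rightarrow> (nat \<Rightarrow> 'v \<Rightarrow> 'v) set" where
  "situations A = (\<Pi>\<^sub>E i\<in>players A. strategies A i)"

definition controller :: "'v arena \<Rightarrow> 'v \<Rightarrow> nat" where
  "controller A v = (THE i. i \<in> players A \<and> v \<in> controlled A i)"

text \<open>
  The play is the sequence of positions visited from the initial position; a play that reaches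
  a terminal position is continued constantly there. This padding never enters a cost, since
  costs only depend on the play up to \<open>play_length\<close>.
\<close>
primrec play :: "'v arena \<Rightarrow> (nat \<Rightarrow> 'v \<Rightarrow> 'v) \<Rightarrow> nat \<Rightarrow> 'v" where
  "play A \<sigma> 0 = start A"
| "play A \<sigma> (Suc k) =
    (let v = play A \<sigma> k in if v \<in> terminals A then v else \<sigma> (controller A v) v)"

definition terminal_play :: "'v arena \<Rightarrow> (nat \<Rightarrow> 'v \<Rightarrow> 'v) \<Rightarrow> bool" where
  "terminal_play A \<sigma> \<longleftrightarrow> (\<exists>k. play A \<sigma> k \<in> terminals A)"

text \<open>Number of moves of a terminal play; meaningless for an infinite play.\<close>
definition play_length :: "'v arena \<Rightarrow> (nat \<Rightarrow> 'v \<Rightarrow> 'v) \<Rightarrow> nat" where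
  "play_length A \<sigma> = (LEAST k. play A \<sigma> k \<in> terminals A)"

definition terminal_cost ::
  "'v arena \<Rightarrow> (nat \<Rightarrow> 'v \<Rightarrow> real) \<Rightarrow> nat \<Rightarrow> (nat \<Rightarrow> 'v \<Rightarrow> 'v) \<Rightarrow> real" where
  "terminal_cost A L i \<sigma> =
    (if terminal_play A \<sigma> then L i (play A \<sigma> (play_length A \<sigma>)) else 0)"

definition path_cost ::
  "'v arena \<Rightarrow> (nat \<Rightarrow> 'v \<times> 'v \<Rightarrow> real) \<Rightarrow> nat \<Rightarrow> (nat \<Rightarrow> 'v \<Rightarrow> 'v) \<Rightarrow> ereal" where
  "path_cost A l i \<sigma> =
    (if terminal_play A \<sigma>
     then ereal (\<Sum>k<play_length A \<sigma>. l i (play A \<sigma> k, play A \<sigma> (Suc k)))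
     else \<infinity>)"

definition nash_equilibrium ::
  "'v arena \<Rightarrow> (nat \<Rightarrow> (nat \<Rightarrow> 'v \<Rightarrow> 'v) \<Rightarrow> 'c::linorder) \<Rightarrow> (nat \<Rightarrow> 'v \<Rightarrow> 'v) \<Rightarrow> bool" where
  "nash_equilibrium A cost \<sigma> \<longleftrightarrow>
    \<sigma> \<in> situations A \<and>
    (\<forall>i\<in>players A. \<forall>\<tau>\<in>strategies A i. \<not> cost i (\<sigma>(i := \<tau>)) < cost i \<sigma>)"

definition terminal_nash_equilibrium ::
  "'v arena \<Rightarrow> (nat \<Rightarrow> (nat \<Rightarrow> 'v \<Rightarrow> 'v) \<Rightarrow> 'c::linorder) \<Rightarrow> (nat \<Rightarrow> 'v \<Rightarrow> 'v) \<Rightarrow> bool" where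
  "terminal_nash_equilibrium A cost \<sigma> \<longleftrightarrow> nash_equilibrium A cost \<sigma> \<and> terminal_play A \<sigma>"

definition infinite_plays_worst :: "'v arena \<Rightarrow> (nat \<Rightarrow> 'v \<Rightarrow> real) \<Rightarrow> bool" where
  "infinite_plays_worst A L \<longleftrightarrow> (\<forall>i\<in>players A. \<forall>w\<in>terminals A. L i w < 0)"

definition positive_local_costs :: "'v arena \<Rightarrow> (nat \<Rightarrow> 'v \<times> 'v \<Rightarrow> real) \<Rightarrow> bool" where
  "positive_local_costs A l \<longleftrightarrow> (\<forall>i\<in>players A. \<forall>e\<in>moves A. l i e > 0)"

end

theory Submission
  imports Defs
begin

text \<open>
  Charge one unit per move, plus \<open>card V\<close> times the rank of \<open>w\<close> in the order of
  \<open>\<L>\<^sup>i\<close> for a move into the terminal \<open>w\<close>. A terminal play repeats no position, so it has at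
  most \<open>card V\<close> moves and its length never outweighs a difference in rank. Since infinite plays
  are worst, a deviation that improves a terminal situation in the terminal game leads to a
  terminal of smaller rank, hence to a cheaper path.
\<close>

lemma play_length_terminal:
  assumes "terminal_play A \<sigma>"
  shows "play A \<sigma> (play_length A \<sigma>) \<in> terminals A"
  using assms unfolding terminal_play_def play_length_def by (rule LeastI_ex)

lemma not_terminal_before_play_length:
  assumes "k < play_length A \<sigma>"
  shows "play A \<sigma> k \<notin> terminals A"
  using assms not_less_Least unfolding play_length_def by blast

text \<open>Strategies are stationary: the next position depends on the current one alone, so a
  repeated position repeats everything after it.\<close>

lemma play_shift:
  assumes "play A \<sigma> j = play A \<sigma> k"
  shows "play A \<sigma> (j + m) = play A \<sigma> (k + m)"
  using assms by (induction m) simp_all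

text \<open>If positions j < k before the end agreed, shifting both by
  \<open>play_length A \<sigma> - k\<close> would place a terminal at an index below
  \<open>play_length\<close>, against minimality.\<close>

lemma inj_on_play:
  assumes "terminal_play A \<sigma>"
  shows "inj_on (play A \<sigma>) {..<play_length A \<sigma>}"
proof (rule linorder_inj_onI)
  fix j k
  assume "j < k" "j \<in> {..<play_length A \<sigma>}" "k \<in> {..<play_length A \<sigma>}"
  then have "k + (play_length A \<sigma> - k) = play_length A \<sigma>"
    and early: "j + (play_length A \<sigma> - k) < play_length A \<sigma>" by auto
  then show "play A \<sigma> j \<noteq> play A \<sigma> k"
    using play_shift[of A \<sigma> j k "play_length A \<sigma> - k"] play_length_terminal[OF assms]
      not_terminal_before_play_length[OF early] by auto
qed auto

lemma situations_fun_upd: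
  assumes "\<sigma> \<in> situations A" "i \<in> players A" "\<tau> \<in> strategies A i"
  shows "\<sigma>(i := \<tau>) \<in> situations A"
  using assms unfolding situations_def by (auto simp: PiE_iff extensional_def)

context game_arena
begin

lemma controller_eq:
  assumes "i \<in> players A" "v \<in> controlled A i"
  shows "controller A v = i"
  unfolding controller_def using assms controlled_disjoint
  by (intro the_equality) (blast dest: disjoint_family_onD)+

lemma play_in_positions:
  assumes "\<sigma> \<in> situations A"
  shows "play A \<sigma> k \<in> positions A"
proof (induction k)
  case 0
  show ?case using start_position by simp
next
  case (Suc k)
  let ?v = "play A \<sigma> k"
  show ?case
  proof (cases "?v \<in> terminals A")
    case True
    then show ?thesis using Suc by simp
  next
    case False
    then obtain i where i: "i \<in> players A" "?v \<in> controlled A i"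
      using Suc positions_cover by blast
    then have "(?v, \<sigma> i ?v) \<in> moves A"
      using assms unfolding situations_def strategies_def by (fastforce simp: PiE_iff)
    then have "\<sigma> i ?v \<in> positions A"
      using pair_wf_digraph.in_arcsD2[OF pair_fin_digraph.axioms(1)[OF finite_digraph]] by blast
    then show ?thesis
      using False controller_eq[OF i] by simp
  qed
qed

lemma finite_positions: "finite (positions A)"
  using finite_digraph by (rule pair_fin_digraph.pair_finite_verts)

lemma play_length_le_card:
  assumes "\<sigma> \<in> situations A" "terminal_play A \<sigma>"
  shows "play_length A \<sigma> \<le> card (positions A)"
  using card_inj_on_le[OF inj_on_play[OF assms(2)] _ finite_positions]
    play_in_positions[OF assms(1)] by auto

text \<open>Guarantees a last move, which carries the surcharge.\<close>

lemma play_length_pos: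
  assumes "terminal_play A \<sigma>"
  shows "play_length A \<sigma> > 0"
  using play_length_terminal[OF assms] start_position by (intro gr0I) auto

text \<open>Only the last move enters a terminal, so the surcharge \<open>c\<close> is paid exactly
  once.\<close>

lemma path_cost_terminal_surcharge:
  assumes "terminal_play A \<sigma>"
  shows "path_cost A (\<lambda>i e. 1 + (if snd e \<in> terminals A then c i (snd e) else 0)) i \<sigma>
    = ereal (real (play_length A \<sigma>) + c i (play A \<sigma> (play_length A \<sigma>)))"
proof -
  obtain n where n: "play_length A \<sigma> = Suc n"
    using play_length_pos[OF assms] gr0_implies_Suc by blast
  have "play A \<sigma> (Suc k) \<notin> terminals A" if "k < n" for k
    using that n by (intro not_terminal_before_play_length) simp
  moreover have "play A \<sigma> (Suc n) \<in> terminals A"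
    using play_length_terminal[OF assms] n by simp
  \<comment> \<open>\<open>play\<close> stays folded at successors so that both facts decide the
    conditionals in the sum.\<close>
  ultimately show ?thesis
    using assms unfolding path_cost_def n by (simp del: play.simps)
qed

end

theorem theorem4:
  fixes A :: "'v arena" and L :: "nat \<Rightarrow> 'v \<Rightarrow> real"
  assumes "game_arena A"
    and "infinite_plays_worst A L"
  shows "\<exists>l :: nat \<Rightarrow> 'v \<times> 'v \<Rightarrow> real.
    positive_local_costs A l \<and>
    (\<forall>\<sigma>. terminal_nash_equilibrium A (path_cost A l) \<sigma> \<longrightarrow>
          nash_equilibrium A (terminal_cost A L) \<sigma>)"
proof -
  interpret game_arena A by (rule assms(1))
  define N where "N = card (positions A)"
  \<comment> \<open>Ranks replace the values of \<open>L\<close>, whose gaps may be arbitrarily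
    small: distinct ranks differ by at least 1, and ties share a rank.\<close>
  define r where "r i w = card {u \<in> terminals A. L i u < L i w}" for i w
  define l :: "nat \<Rightarrow> 'v \<times> 'v \<Rightarrow> real" where
    "l = (\<lambda>i e. 1 + (if snd e \<in> terminals A then real (N * r i (snd e)) else 0))"
  have r_mono: "r i u < r i w" if "u \<in> terminals A" "L i u < L i w" for i u w
    unfolding r_def
  proof (rule psubset_card_mono)
    show "finite {u \<in> terminals A. L i u < L i w}"
      using finite_positions positions_cover by simp
    \<comment> \<open>Strict, since \<open>u\<close> lies only in the right-hand set.\<close>
    show "{u' \<in> terminals A. L i u' < L i u} \<subset> {u \<in> terminals A. L i u < L i w}"
      using that by auto
  qed
  \<comment> \<open>Here \<sigma>' may be any situation, not just a deviation of player i.\<close>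
  have improves: "path_cost A l i \<sigma>' < path_cost A l i \<sigma>"
    if "terminal_play A \<sigma>" "\<sigma>' \<in> situations A" "i \<in> players A"
      and less: "terminal_cost A L i \<sigma>' < terminal_cost A L i \<sigma>" for i \<sigma> \<sigma>'
  proof -
    let ?w = "play A \<sigma> (play_length A \<sigma>)" and ?w' = "play A \<sigma>' (play_length A \<sigma>')"
    \<comment> \<open>An infinite play costs 0, so undercutting a negative cost forces \<sigma>' to
      terminate.\<close>
    have "terminal_cost A L i \<sigma> < 0"
      using assms(2) play_length_terminal[OF that(1)] that(1,3)
      by (auto simp: terminal_cost_def infinite_plays_worst_def)
    with less have term': "terminal_play A \<sigma>'"
      by (auto simp: terminal_cost_def split: if_splits)
    have "r i ?w' < r i ?w"
      using less r_mono play_length_terminal[OF term'] that(1) term'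
      by (simp add: terminal_cost_def)
    \<comment> \<open>A rank drop of at least 1 saves at least \<open>N\<close>, which pays for the
      whole length of the new play; strictness then comes from the positive length of the old
      one.\<close>
    then have "N * Suc (r i ?w') \<le> N * r i ?w"
      by (intro mult_le_mono2) simp
    moreover have "play_length A \<sigma>' \<le> N"
      unfolding N_def using that(2) term' by (rule play_length_le_card)
    ultimately have "play_length A \<sigma>' + N * r i ?w' < play_length A \<sigma> + N * r i ?w"
      using play_length_pos[OF that(1)] by simp
    then show ?thesis
      unfolding l_def path_cost_terminal_surcharge[OF that(1), of "\<lambda>i w. real (N * r i w)"]
        path_cost_terminal_surcharge[OF term', of "\<lambda>i w. real (N * r i w)"]
      by (simp flip: of_nat_add of_nat_mult)
  qed
  show ?thesis
  proof (intro exI conjI allI impI)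
    show "positive_local_costs A l"
      by (auto simp: positive_local_costs_def l_def intro: add_pos_nonneg)
    fix \<sigma>
    assume "terminal_nash_equilibrium A (path_cost A l) \<sigma>"
    then show "nash_equilibrium A (terminal_cost A L) \<sigma>"
      unfolding terminal_nash_equilibrium_def nash_equilibrium_def
      using improves situations_fun_upd by blast
  qed
qed

end
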